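(* Let $a,b>0$ and let $E=\{(x,y)\in\mathbb{R}^2:\ x^2/a^2+y^2/b^2=1\}$. For a 3-periodic billiard trajectory in $E$, let $\theta_1',\theta_2',\theta_3'$ be the interior angles of the excentral triangle of the triangle formed by its vertices. Then the product $\cos\theta_1'\cos\theta_2'\cos\theta_3'$ is the same for all 3-periodic billiard trajectories in $E$.
   Context: Elliptic billiard: a particle moves in straight lines at constant speed inside $E$ and bounces elastically on $E$, i.e. at each bounce point the incoming and outgoing segments make equal angles with the normal to $E$. A 3-periodic trajectory (orbit) is a closed billiard trajectory with three bounce points, that is, a non-degenerate triangle $P_1P_2P_3$ inscribed in $E$ such that at each vertex the normal to $E$ bisects the interior angle of the triangle. For a fixed ellipse $E$ these triangles form a one-parameter family (the 3-periodic family); a quantity is conserved by the family if it takes the same value on all of its members. Excentral triangle of $P_1P_2P_3$: through each $P_i$ draw the line perpendicular to the interior angle bisector at $P_i$; the excentral triangle is the triangle whose vertices are the three pairwise intersections of these lines (the excenters). *)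

theory Defs
  imports "HOL-Analysis.Analysis"
begin

text \<open>Unsigned angle at the middle point, in \<open>[0, pi]\<close>; meaningful only if \<open>A \<noteq> B\<close> and \<open>C \<noteq> B\<close>.\<close>

definition angle_at :: "'a::real_inner \<Rightarrow> 'a \<Rightarrow> 'a \<Rightarrow> real" where
  "angle_at A B C = arccos ((A - B) \<bullet> (C - B) / (norm (A - B) * norm (C - B)))"

definition bisector_ray :: "real \<times> real \<Rightarrow> real \<times> real \<Rightarrow> real \<times> real \<Rightarrow> (real \<times> real) set" where
  "bisector_ray A B C =
     {X. X = B \<or> angle_at A B X = angle_at A B C / 2 \<and> angle_at X B C = angle_at A B C / 2}"

definition ellipse :: "real \<Rightarrow> real \<Rightarrow> (real \<times> real) set" where
  "ellipse a b = {(x, y). x\<^sup>2 / a\<^sup>2 + y\<^sup>2 / b\<^sup>2 = 1}"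

text \<open>The direction vector is half the gradient of \<open>x\<^sup>2 / a\<^sup>2 + y\<^sup>2 / b\<^sup>2\<close> at the point.\<close>

definition normal_line :: "real \<Rightarrow> real \<Rightarrow> real \<times> real \<Rightarrow> (real \<times> real) set" where
  "normal_line a b P = {P + t *\<^sub>R (fst P / a\<^sup>2, snd P / b\<^sup>2) | t. True}"

definition billiard_orbit3 ::
  "real \<Rightarrow> real \<Rightarrow> real \<times> real \<Rightarrow> real \<times> real \<Rightarrow> real \<times> real \<Rightarrow> bool" where
  "billiard_orbit3 a b P1 P2 P3 \<longleftrightarrow>
     P1 \<in> ellipse a b \<and> P2 \<in> ellipse a b \<and> P3 \<in> ellipse a b \<and>
     \<not> collinear {P1, P2, P3} \<and>
     normal_line a b P1 = affine hull (bisector_ray P2 P1 P3) \<and>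
     normal_line a b P2 = affine hull (bisector_ray P3 P2 P1) \<and>
     normal_line a b P3 = affine hull (bisector_ray P1 P3 P2)"

text \<open>The line through \<open>B\<close> perpendicular to the interior bisector of the angle \<open>A B C\<close>.\<close>

definition exterior_bisector :: "real \<times> real \<Rightarrow> real \<times> real \<Rightarrow> real \<times> real \<Rightarrow> (real \<times> real) set" where
  "exterior_bisector A B C = {Y. \<forall>X \<in> bisector_ray A B C. orthogonal (Y - B) (X - B)}"

text \<open>
  The vertex of the excentral triangle of \<open>A B C\<close> opposite to \<open>A\<close>, i.e. the common point of the
  lines at \<open>B\<close> and at \<open>C\<close>. These lines meet in exactly one point if \<open>A\<close>, \<open>B\<close>, \<open>C\<close> are not collinear.
\<close>

definition excenter :: "real \<times> real \<Rightarrow> real \<times> real \<Rightarrow> real \<times> real \<Rightarrow> real \<times> real" where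
  "excenter A B C = (THE J. J \<in> exterior_bisector A B C \<and> J \<in> exterior_bisector B C A)"

definition excentral_cos_product :: "real \<times> real \<Rightarrow> real \<times> real \<Rightarrow> real \<times> real \<Rightarrow> real" where
  "excentral_cos_product P1 P2 P3 =
     (let J1 = excenter P1 P2 P3; J2 = excenter P2 P3 P1; J3 = excenter P3 P1 P2
      in cos (angle_at J2 J1 J3) * cos (angle_at J3 J2 J1) * cos (angle_at J1 J3 J2))"

end

theory Submission
  imports Defs
begin

text \<open>
  Write \<open>u\<^sub>i\<^sub>j\<close> for the unit vector from \<open>P\<^sub>i\<close> to \<open>P\<^sub>j\<close>. The excentral side through \<open>P\<^sub>i\<close> has direction
  \<open>u\<^sub>i\<^sub>j - u\<^sub>i\<^sub>k\<close>, so the cosines of the excentral angles are rational in the half angles of the triangle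
  and their product equals \<open>(cos \<theta>\<^sub>1 + cos \<theta>\<^sub>2 + cos \<theta>\<^sub>3 - 1) / 4\<close>.

  With \<open>n\<^sub>i\<close> half the gradient of the ellipse equation at \<open>P\<^sub>i\<close>, the reflection law and \<open>n\<^sub>i \<bullet> P\<^sub>j = n\<^sub>j \<bullet> P\<^sub>i\<close>
  show that \<open>J = - n\<^sub>i \<bullet> u\<^sub>i\<^sub>j\<close> is the same for all \<open>i \<noteq> j\<close>
  (Joachimsthal's integral). Pairing \<open>u\<^sub>i\<^sub>j + u\<^sub>i\<^sub>k\<close> with \<open>P\<^sub>i\<close> and summing over \<open>i\<close> yields
  \<open>J L = 3 + cos \<theta>\<^sub>1 + cos \<theta>\<^sub>2 + cos \<theta>\<^sub>3\<close> for the perimeter \<open>L\<close>.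

  In the coordinates \<open>z = x / a + i y / b\<close> on the unit circle each side satisfies
  \<open>z\<^sup>2 + w\<^sup>2 - k (z\<^sup>2 w\<^sup>2 + 1) = 2 g z w\<close> with \<open>k = J\<^sup>2 (a\<^sup>2 - b\<^sup>2)\<close> and \<open>g = 1 - J\<^sup>2 (a\<^sup>2 + b\<^sup>2)\<close>.
  Subtracting two of the three equations shows that the elementary symmetric functions satisfy
  \<open>e\<^sub>1 = - k e\<^sub>3\<close> and \<open>1 + 2 g + k e\<^sub>2 = 0\<close>, and \<open>e\<^sub>2\<close> is \<open>e\<^sub>3\<close> times the conjugate of \<open>e\<^sub>1\<close>, hence \<open>e\<^sub>2 = - k\<close>.
  So \<open>1 + 2 g = k\<^sup>2\<close>, a quadratic equation for \<open>J\<^sup>2\<close> with only one positive root, and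
  \<open>k\<^sup>2 = e\<^sub>1\<close> times its conjugate determines \<open>J L\<close>.
\<close>

section \<open>Angles and bisectors through unit vectors\<close>

lemma angle_at_sgn: "angle_at A B C = arccos (sgn (A - B) \<bullet> sgn (C - B))"
  by (simp add: angle_at_def sgn_div_norm divide_inverse mult_ac)

lemma abs_inner_sgn_le_1: "\<bar>sgn x \<bullet> sgn y\<bar> \<le> 1" for x y :: "'a::real_inner"
  using Cauchy_Schwarz_ineq2[of "sgn x" "sgn y"] by (auto simp: norm_sgn split: if_splits)

lemma cos_angle_at: "cos (angle_at A B C) = sgn (A - B) \<bullet> sgn (C - B)"
  unfolding angle_at_sgn using abs_inner_sgn_le_1 by (intro cos_arccos_abs)

lemma inner_sgn_self: "x \<noteq> 0 \<Longrightarrow> sgn x \<bullet> sgn x = 1" for x :: "'a::real_inner"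
  using norm_sgn[of x] by (simp add: norm_eq_1)

text \<open>The sum of two unit vectors halves their angle: \<open>u + v\<close> has length
  \<open>2 * cos (\<theta>/2)\<close>, and \<open>u \<bullet> (u + v) = 1 + cos \<theta> = 2 * (cos
  (\<theta>/2))\<^sup>2\<close>.\<close>

lemma arccos_inner_sgn_add:
  fixes u v :: "'a::real_inner"
  assumes u: "norm u = 1" and v: "norm v = 1" and ne: "u + v \<noteq> 0"
  shows "arccos (u \<bullet> sgn (u + v)) = arccos (u \<bullet> v) / 2"
proof -
  define \<theta> where "\<theta> = arccos (u \<bullet> v)"
  have b: "\<bar>u \<bullet> v\<bar> \<le> 1" using Cauchy_Schwarz_ineq2[of u v] u v by simp
  have \<theta>: "0 \<le> \<theta>" "\<theta> \<le> pi" "cos \<theta> = u \<bullet> v"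
    unfolding \<theta>_def using b by (auto intro: arccos_lbound arccos_ubound)
  have uu: "u \<bullet> u = 1" "v \<bullet> v = 1" using u v by (simp_all add: norm_eq_1)
  have c: "u \<bullet> v = 2 * (cos (\<theta>/2))\<^sup>2 - 1" using cos_double_cos[of "\<theta>/2"] \<theta> by simp
  have "(norm (u + v))\<^sup>2 = (2 * cos (\<theta>/2))\<^sup>2"
    unfolding power2_norm_eq_inner using c uu
    by (simp add: inner_add_left inner_add_right inner_commute power_mult_distrib)
  moreover have pos: "0 \<le> cos (\<theta>/2)" using \<theta> by (intro cos_ge_zero) auto
  ultimately have n: "norm (u + v) = 2 * cos (\<theta>/2)"
    by - (rule power2_eq_imp_eq, simp_all)
  have "u \<bullet> sgn (u + v) = (1 + u \<bullet> v) / norm (u + v)"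
    unfolding sgn_div_norm inner_scaleR_right inner_add_right uu(1) by (simp add: divide_inverse)
  also have "\<dots> = cos (\<theta>/2)"
  proof -
    have "cos (\<theta>/2) \<noteq> 0" using ne n by (metis mult_zero_right norm_eq_zero)
    then show ?thesis unfolding n c by (simp add: power2_eq_square)
  qed
  finally show ?thesis using \<theta> by (simp add: arccos_cos \<theta>_def[symmetric])
qed

lemma add_sgn_in_bisector_ray:
  assumes "A \<noteq> B" "C \<noteq> B" "sgn (A - B) + sgn (C - B) \<noteq> 0"
  shows "B + (sgn (A - B) + sgn (C - B)) \<in> bisector_ray A B C"
proof -
  have n: "norm (sgn (A - B)) = 1" "norm (sgn (C - B)) = 1" using assms by (simp_all add: norm_sgn)
  show ?thesis
    using arccos_inner_sgn_add[OF n assms(3)] arccos_inner_sgn_add[OF n(2,1)] assms(3)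
    by (simp add: bisector_ray_def angle_at_sgn add.commute inner_commute)
qed

text \<open>Equal angles have equal cosines, so \<open>X - B\<close> has the same inner product with
  both unit vectors. This confines the whole ray to one line.\<close>

lemma bisector_ray_inner:
  assumes "X \<in> bisector_ray A B C"
  shows "(X - B) \<bullet> (sgn (A - B) - sgn (C - B)) = 0"
proof (cases "X = B")
  case False
  with assms have "angle_at A B X = angle_at X B C"
    by (auto simp: bisector_ray_def)
  then have "cos (angle_at A B X) = cos (angle_at X B C)"
    by simp
  with False show ?thesis
    unfolding cos_angle_at by (simp add: sgn_div_norm inner_diff_right inner_commute)
qed simp

text \<open>In the plane the orthogonal complement of \<open>d\<close> is a line: both components of
  \<open>d\<close> annihilate the determinant of \<open>u\<close> and \<open>w\<close>.\<close>

lemma orthogonal_imp_parallel: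
  fixes d u w :: "real \<times> real"
  assumes "d \<noteq> 0" "u \<noteq> 0" "u \<bullet> d = 0" "w \<bullet> d = 0"
  shows "\<exists>c. w = c *\<^sub>R u"
proof -
  obtain d1 d2 u1 u2 w1 w2 where e: "d = (d1, d2)" "u = (u1, u2)" "w = (w1, w2)"
    by (metis surj_pair)
  have h: "u1*d1 + u2*d2 = 0" "w1*d1 + w2*d2 = 0" "d1 \<noteq> 0 \<or> d2 \<noteq> 0" "u1 \<noteq> 0 \<or> u2 \<noteq> 0"
    using assms by (auto simp: e zero_prod_def)
  have "d1 * (w1*u2 - w2*u1) = 0" "d2 * (w1*u2 - w2*u1) = 0" using h(1,2) by algebra+
  then have x: "w1*u2 = w2*u1" using h(3) by auto
  show ?thesis
  proof (cases "u1 = 0")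
    case True
    then show ?thesis using h(4) x by (intro exI[of _ "w2/u2"]) (auto simp: e field_simps)
  next
    case False
    then show ?thesis using x by (intro exI[of _ "w1/u1"]) (auto simp: e field_simps)
  qed
qed

lemma scaleR_norm_sgn: "norm x *\<^sub>R sgn x = x" for x :: "'a::real_normed_vector"
  by (cases "x = 0") (simp_all add: sgn_div_norm)

lemma collinear_sgnI:
  fixes A B C :: "'a::real_inner"
  assumes "sgn (A - B) = c *\<^sub>R sgn (C - B)"
  shows "collinear {A, B, C}"
proof (cases "C = B")
  case False
  have "A - B = norm (A - B) *\<^sub>R sgn (A - B)" by (simp add: scaleR_norm_sgn)
  also have "\<dots> = (norm (A - B) * c / norm (C - B)) *\<^sub>R (C - B)"
    unfolding assms by (simp add: sgn_div_norm divide_inverse mult_ac)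
  finally have "collinear {0, C - B, A - B}"
    unfolding collinear_lemma by blast
  then have "collinear {C, B, A}" by (subst collinear_3) auto
  then show ?thesis by (simp add: insert_commute)
qed simp

lemma not_collinear_sgn:
  fixes A B C :: "'a::real_inner"
  assumes "\<not> collinear {A, B, C}"
  shows "A \<noteq> B" "C \<noteq> B" "A \<noteq> C" "sgn (A - B) + sgn (C - B) \<noteq> 0" "sgn (A - B) - sgn (C - B) \<noteq> 0"
proof -
  show "A \<noteq> B" "C \<noteq> B" "A \<noteq> C" using assms by (auto simp: insert_commute)
  show "sgn (A - B) + sgn (C - B) \<noteq> 0"
    using collinear_sgnI[of A B "-1" C] assms by (auto simp: add_eq_0_iff2)
  show "sgn (A - B) - sgn (C - B) \<noteq> 0"
    using collinear_sgnI[of A B 1 C] assms by auto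
qed

text \<open>The diagonals of a rhombus are perpendicular.\<close>

lemma inner_add_diff_sgn:
  fixes x y :: "'a::real_inner"
  assumes "x \<noteq> 0" "y \<noteq> 0"
  shows "(sgn x + sgn y) \<bullet> (sgn x - sgn y) = 0"
  using inner_sgn_self[OF assms(1)] inner_sgn_self[OF assms(2)] inner_commute[of "sgn x" "sgn y"]
  by (simp add: inner_add_left inner_diff_right)

section \<open>Exterior bisectors and excenters\<close>

text \<open>One direction tests the definition on a single point of the ray other than
  \<open>B\<close>; the other uses that every point of the ray differs from \<open>B\<close> by a
  multiple of the sum of the unit vectors.\<close>

lemma mem_exterior_bisector_iff:
  assumes "\<not> collinear {A, B, C}"
  shows "Y \<in> exterior_bisector A B C \<longleftrightarrow> (Y - B) \<bullet> (sgn (A - B) + sgn (C - B)) = 0"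
proof
  assume "Y \<in> exterior_bisector A B C"
  then show "(Y - B) \<bullet> (sgn (A - B) + sgn (C - B)) = 0"
    using add_sgn_in_bisector_ray[of A B C] not_collinear_sgn[OF assms]
    by (fastforce simp: exterior_bisector_def orthogonal_def)
next
  assume Y: "(Y - B) \<bullet> (sgn (A - B) + sgn (C - B)) = 0"
  note nc = not_collinear_sgn[OF assms]
  have "(Y - B) \<bullet> (X - B) = 0" if "X \<in> bisector_ray A B C" for X
  proof -
    have "\<exists>c. X - B = c *\<^sub>R (sgn (A - B) + sgn (C - B))"
      using nc bisector_ray_inner[OF that]
      by (intro orthogonal_imp_parallel[of "sgn (A - B) - sgn (C - B)"] inner_add_diff_sgn) auto
    with Y show ?thesis by auto
  qed
  then show "Y \<in> exterior_bisector A B C"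
    by (auto simp: exterior_bisector_def orthogonal_def)
qed

lemma strict_triangle_ineq:
  fixes A B C :: "'a::euclidean_space"
  assumes "\<not> collinear {A, B, C}"
  shows "dist A C < dist A B + dist B C"
proof -
  have "\<not> between (A, C) B"
    using assms between_imp_collinear[of A C B] by (auto simp: insert_commute)
  then show ?thesis using dist_triangle[of A C B] by (simp add: between)
qed

lemma dist_scaleR_sgn: "dist A B *\<^sub>R sgn (B - A) = B - A" for A B :: "'a::real_normed_vector"
  using scaleR_norm_sgn[of "B - A"] by (simp add: dist_norm norm_minus_commute)

lemma sgn_diff_commute: "sgn (A - B) = - sgn (B - A)" for A B :: "'a::real_normed_vector"
  using sgn_minus[of "B - A"] by simp

text \<open>Both forms come from the barycentric weights \<open>-p : q : r\<close> of the excenter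
  opposite \<open>A\<close>. They locate it on the exterior bisectors at \<open>B\<close> and at
  \<open>C\<close>, with a positive coefficient because \<open>s > 0\<close>.\<close>

lemma excenter_eq:
  assumes nc: "\<not> collinear {A, B, C}"
  defines "s \<equiv> dist C A + dist A B - dist B C"
  shows "excenter A B C = B + (dist B C * dist A B / s) *\<^sub>R (sgn (C - B) - sgn (A - B))"
    and "excenter A B C = C + (dist B C * dist C A / s) *\<^sub>R (sgn (B - C) - sgn (A - C))"
proof -
  define p q r where "p = dist B C" and "q = dist C A" and "r = dist A B"
  have nc': "\<not> collinear {B, C, A}" "\<not> collinear {B, A, C}" using nc by (simp_all add: insert_commute)
  note n1 = not_collinear_sgn[OF nc] and n2 = not_collinear_sgn[OF nc'(1)]
  have s: "s = q + r - p" "s > 0"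
    using strict_triangle_ineq[OF nc'(2)] by (simp_all add: s_def p_def q_def r_def dist_commute)
  have pqr: "p > 0" "q > 0" "r > 0" using n1 by (auto simp: p_def q_def r_def)
  define J where "J = (1/s) *\<^sub>R (q *\<^sub>R B + r *\<^sub>R C - p *\<^sub>R A)"
  have sJ: "s *\<^sub>R J = q *\<^sub>R B + r *\<^sub>R C - p *\<^sub>R A" using s by (simp add: J_def)
  have rp: "r *\<^sub>R sgn (A - B) = A - B" "p *\<^sub>R sgn (C - B) = C - B" "p *\<^sub>R sgn (B - C) = B - C"
      "q *\<^sub>R sgn (A - C) = A - C"
    using dist_scaleR_sgn[of B A] dist_scaleR_sgn[of B C] dist_scaleR_sgn[of C B] dist_scaleR_sgn[of C A]
    by (simp_all add: p_def q_def r_def dist_commute)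
  have "s *\<^sub>R (J - B) = r *\<^sub>R (C - B) - p *\<^sub>R (A - B)"
    unfolding scaleR_diff_right sJ by (simp add: s(1) algebra_simps)
  also have "\<dots> = (p * r) *\<^sub>R (sgn (C - B) - sgn (A - B))"
  proof -
    have "(p * r) *\<^sub>R (sgn (C - B) - sgn (A - B)) =
        r *\<^sub>R (p *\<^sub>R sgn (C - B)) - p *\<^sub>R (r *\<^sub>R sgn (A - B))"
      by (simp add: scaleR_diff_right mult.commute)
    then show ?thesis by (simp only: rp)
  qed
  finally have "(1/s) *\<^sub>R s *\<^sub>R (J - B) = (1/s) *\<^sub>R (p * r) *\<^sub>R (sgn (C - B) - sgn (A - B))" by simp
  then have JB: "J - B = (p * r / s) *\<^sub>R (sgn (C - B) - sgn (A - B))" using s by simp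
  have "s *\<^sub>R (J - C) = q *\<^sub>R (B - C) - p *\<^sub>R (A - C)"
    unfolding scaleR_diff_right sJ by (simp add: s(1) algebra_simps)
  also have "\<dots> = (p * q) *\<^sub>R (sgn (B - C) - sgn (A - C))"
  proof -
    have "(p * q) *\<^sub>R (sgn (B - C) - sgn (A - C)) =
        q *\<^sub>R (p *\<^sub>R sgn (B - C)) - p *\<^sub>R (q *\<^sub>R sgn (A - C))"
      by (simp add: scaleR_diff_right mult.commute)
    then show ?thesis by (simp only: rp)
  qed
  finally have "(1/s) *\<^sub>R s *\<^sub>R (J - C) = (1/s) *\<^sub>R (p * q) *\<^sub>R (sgn (B - C) - sgn (A - C))" by simp
  then have JC: "J - C = (p * q / s) *\<^sub>R (sgn (B - C) - sgn (A - C))" using s by simp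
  have "excenter A B C = J"
    unfolding excenter_def mem_exterior_bisector_iff[OF nc] mem_exterior_bisector_iff[OF nc'(1)]
  proof (rule the_equality)
    show J: "(J - B) \<bullet> (sgn (A - B) + sgn (C - B)) = 0 \<and> (J - C) \<bullet> (sgn (B - C) + sgn (A - C)) = 0"
      unfolding JB JC using n1 inner_add_diff_sgn[of "A - B" "C - B"] inner_add_diff_sgn[of "A - C" "B - C"]
      by (simp add: inner_add_left inner_add_right inner_diff_left inner_diff_right inner_commute)
    fix K
    assume K: "(K - B) \<bullet> (sgn (A - B) + sgn (C - B)) = 0 \<and> (K - C) \<bullet> (sgn (B - C) + sgn (A - C)) = 0"
    \<comment> \<open>Uniqueness: with \<open>x = d \<bullet> sgn (C - B)\<close>, splitting
      \<open>C - B\<close> as \<open>(A - B) - (A - C)\<close> turns the two orthogonality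
      conditions into \<open>p * x = - r * x - q * x\<close>.\<close>
    define d where "d = K - J"
    have d: "d \<bullet> sgn (A - B) = - (d \<bullet> sgn (C - B))" "d \<bullet> sgn (A - C) = d \<bullet> sgn (C - B)"
      using J K unfolding sgn_diff_commute[of B C]
      by (simp_all add: d_def inner_diff_left inner_diff_right inner_add_right)
    have "p * (d \<bullet> sgn (C - B)) = d \<bullet> (C - B)" by (metis inner_scaleR_right rp(2))
    also have "\<dots> = d \<bullet> (A - B) - d \<bullet> (A - C)" by (simp add: inner_diff_right)
    also have "\<dots> = r * (d \<bullet> sgn (A - B)) - q * (d \<bullet> sgn (A - C))" by (metis inner_scaleR_right rp(1,4))
    finally have "(p + q + r) * (d \<bullet> sgn (C - B)) = 0" using d by (simp add: algebra_simps)
    then have z: "d \<bullet> sgn (C - B) = 0" using pqr by auto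
    \<comment> \<open>A nonzero \<open>d\<close> orthogonal to two sides would make them
      parallel.\<close>
    have "d = 0"
    proof (rule ccontr)
      assume "d \<noteq> 0"
      then have "\<exists>c. sgn (A - B) = c *\<^sub>R sgn (C - B)"
        using n1 z d by (intro orthogonal_imp_parallel[of d]) (auto simp: inner_commute sgn_zero_iff)
      then show False using collinear_sgnI nc by blast
    qed
    then show "K = J" by (simp add: d_def)
  qed
  then show "excenter A B C = B + (dist B C * dist A B / s) *\<^sub>R (sgn (C - B) - sgn (A - B))"
    and "excenter A B C = C + (dist B C * dist C A / s) *\<^sub>R (sgn (B - C) - sgn (A - C))"
    using JB JC by (simp_all add: p_def q_def r_def algebra_simps)
qed

section \<open>Cosines of the excentral angles\<close>

text \<open>The left-hand side is the Gram determinant of three vectors in a two-dimensional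
  space.\<close>

lemma gram_unit_plane:
  fixes u v w :: "real \<times> real"
  assumes "norm u = 1" "norm v = 1" "norm w = 1"
  shows "1 - (u \<bullet> v)\<^sup>2 - (v \<bullet> w)\<^sup>2 - (w \<bullet> u)\<^sup>2 + 2 * (u \<bullet> v) * (v \<bullet> w) * (w \<bullet> u) = 0"
proof -
  obtain u1 u2 v1 v2 w1 w2 where e: "u = (u1, u2)" "v = (v1, v2)" "w = (w1, w2)"
    by (metis surj_pair)
  have "u1^2 + u2^2 = 1" "v1^2 + v2^2 = 1" "w1^2 + w2^2 = 1"
    using assms by (simp_all add: e norm_Pair)
  then show ?thesis unfolding e inner_prod_def inner_real_def fst_conv snd_conv by algebra
qed

text \<open>The Gram relation for the unit side vectors taken cyclically; consecutive ones enclose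
  the exterior angles, so each inner product is minus a cosine.\<close>

lemma cos_triangle_relation:
  fixes A B C :: "real \<times> real"
  assumes "\<not> collinear {A, B, C}"
  defines "x \<equiv> cos (angle_at B A C)" and "y \<equiv> cos (angle_at C B A)" and "z \<equiv> cos (angle_at A C B)"
  shows "x\<^sup>2 + y\<^sup>2 + z\<^sup>2 + 2 * x * y * z = 1"
proof -
  have "A \<noteq> B" "B \<noteq> C" "C \<noteq> A" using not_collinear_sgn[OF assms(1)] by auto
  then have "norm (sgn (B - A)) = 1" "norm (sgn (C - B)) = 1" "norm (sgn (A - C)) = 1"
    by (auto simp: norm_sgn)
  note g = gram_unit_plane[OF this]
  have "sgn (B - A) \<bullet> sgn (C - B) = - y" "sgn (C - B) \<bullet> sgn (A - C) = - z"
    "sgn (A - C) \<bullet> sgn (B - A) = - x"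
    unfolding x_def y_def z_def cos_angle_at
      sgn_diff_commute[of C B] sgn_diff_commute[of B A] sgn_diff_commute[of C A]
    by (simp_all add: inner_commute)
  with g show ?thesis by (simp add: mult_ac)
qed

lemma norm_diff_sgn:
  assumes "A \<noteq> B" "C \<noteq> B"
  shows "norm (sgn (A - B) - sgn (C - B)) = sqrt (2 - 2 * cos (angle_at A B C))"
proof -
  have "sgn (A - B) \<bullet> sgn (A - B) = 1" "sgn (C - B) \<bullet> sgn (C - B) = 1"
    using assms by (simp_all add: inner_sgn_self)
  then show ?thesis
    using inner_commute[of "sgn (C - B)" "sgn (A - B)"]
    by (simp add: norm_eq_sqrt_inner inner_diff_left inner_diff_right cos_angle_at)
qed

lemma cos_angle_excentral:
  assumes nc: "\<not> collinear {A, B, C}"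
  shows "cos (angle_at (excenter B C A) (excenter A B C) (excenter C A B)) =
    (cos (angle_at B A C) + cos (angle_at C B A) + cos (angle_at A C B) - 1) /
    (sqrt (2 - 2 * cos (angle_at C B A)) * sqrt (2 - 2 * cos (angle_at A C B)))"
proof -
  define p q r where "p = dist B C" and "q = dist C A" and "r = dist A B"
  have nc': "\<not> collinear {B, C, A}" "\<not> collinear {C, A, B}" "\<not> collinear {B, A, C}" "\<not> collinear {A, C, B}"
    using nc by (simp_all add: insert_commute)
  note n1 = not_collinear_sgn[OF nc]
  have pqr: "p > 0" "q > 0" "r > 0" using n1 by (auto simp: p_def q_def r_def)
  have tri: "q + r - p > 0" "r + p - q > 0" "p + q - r > 0"
    using strict_triangle_ineq[OF nc'(3)] strict_triangle_ineq[OF nc] strict_triangle_ineq[OF nc'(4)]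
    by (simp_all add: p_def q_def r_def dist_commute)
  \<comment> \<open>Both excenters lie on the exterior bisector at \<open>B\<close>, on opposite
    sides of \<open>B\<close>, so the coefficients add up. Their positive sum keeps the angle from
    being replaced by its supplement.\<close>
  have "excenter C A B - excenter A B C =
      (r * p / (p + q - r) + p * r / (q + r - p)) *\<^sub>R (sgn (A - B) - sgn (C - B))"
    unfolding excenter_eq(1)[OF nc] excenter_eq(2)[OF nc'(2)] p_def q_def r_def
    by (simp add: algebra_simps)
  moreover have "r * p / (p + q - r) + p * r / (q + r - p) > 0"
    using pqr tri by (intro add_pos_pos divide_pos_pos) auto
  ultimately have s3: "sgn (excenter C A B - excenter A B C) = sgn (sgn (A - B) - sgn (C - B))"
    by (simp add: sgn_scaleR)
  have "excenter B C A - excenter A B C =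
      (q * p / (r + p - q) + p * q / (q + r - p)) *\<^sub>R (sgn (A - C) - sgn (B - C))"
    unfolding excenter_eq(2)[OF nc] excenter_eq(1)[OF nc'(1)] p_def q_def r_def
    by (simp add: algebra_simps)
  moreover have "q * p / (r + p - q) + p * q / (q + r - p) > 0"
    using pqr tri by (intro add_pos_pos divide_pos_pos) auto
  ultimately have s2: "sgn (excenter B C A - excenter A B C) = sgn (sgn (A - C) - sgn (B - C))"
    by (simp add: sgn_scaleR)
  have "(sgn (A - C) - sgn (B - C)) \<bullet> (sgn (A - B) - sgn (C - B)) =
      cos (angle_at B A C) + cos (angle_at C B A) + cos (angle_at A C B) - 1"
    unfolding cos_angle_at sgn_diff_commute[of B A] sgn_diff_commute[of C B] sgn_diff_commute[of C A]
    using n1 by (simp add: inner_add_left inner_add_right inner_diff_left inner_diff_right inner_sgn_self)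
      (simp add: inner_commute)
  moreover have "norm (sgn (A - B) - sgn (C - B)) = sqrt (2 - 2 * cos (angle_at C B A))"
    "norm (sgn (A - C) - sgn (B - C)) = sqrt (2 - 2 * cos (angle_at A C B))"
    using norm_diff_sgn[of A B C] norm_diff_sgn[of A C B] n1
    by (auto simp: cos_angle_at inner_commute)
  ultimately show ?thesis
    unfolding cos_angle_at[of "excenter B C A"] s2 s3
    by (simp add: sgn_div_norm divide_inverse mult_ac)
qed

text \<open>Each half-angle root occurs twice in the product of the three denominators, and the
  cosine relation identifies \<open>8 * (1 - x) * (1 - y) * (1 - z)\<close> with
  \<open>4 * S\<^sup>2\<close>.\<close>

lemma excentral_cos_product_eq:
  assumes nc: "\<not> collinear {A, B, C}"
  shows "excentral_cos_product A B C =
    (cos (angle_at B A C) + cos (angle_at C B A) + cos (angle_at A C B) - 1) / 4"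
proof -
  have nc': "\<not> collinear {B, C, A}" "\<not> collinear {C, A, B}"
    using nc by (simp_all add: insert_commute)
  define x y z where "x = cos (angle_at B A C)" and "y = cos (angle_at C B A)" and "z = cos (angle_at A C B)"
  define S where "S = x + y + z - 1"
  define X Y Z where "X = sqrt (2 - 2 * x)" and "Y = sqrt (2 - 2 * y)" and "Z = sqrt (2 - 2 * z)"
  have sw: "x = cos (angle_at C A B)" "y = cos (angle_at A B C)" "z = cos (angle_at B C A)"
    by (simp_all add: x_def y_def z_def cos_angle_at inner_commute)
  have XYZ: "X\<^sup>2 = 2 - 2 * x" "Y\<^sup>2 = 2 - 2 * y" "Z\<^sup>2 = 2 - 2 * z"
    by (simp_all add: X_def Y_def Z_def x_def y_def z_def)
  have rel: "x\<^sup>2 + y\<^sup>2 + z\<^sup>2 + 2 * x * y * z = 1"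
    unfolding x_def y_def z_def by (rule cos_triangle_relation[OF nc])
  have prod: "X\<^sup>2 * Y\<^sup>2 * Z\<^sup>2 = 4 * S\<^sup>2"
    unfolding XYZ S_def using rel by algebra
  have "excentral_cos_product A B C = (S / (Y * Z)) * (S / (Z * X)) * (S / (X * Y))"
    using cos_angle_excentral[OF nc] cos_angle_excentral[OF nc'(1)] cos_angle_excentral[OF nc'(2)]
    unfolding excentral_cos_product_def Let_def
    by (simp add: x_def[symmetric] y_def[symmetric] z_def[symmetric] sw[symmetric] S_def
        X_def Y_def Z_def add_ac)
  also have "\<dots> = S ^ 3 / (X\<^sup>2 * Y\<^sup>2 * Z\<^sup>2)"
    by (simp add: power2_eq_square power3_eq_cube mult_ac)
  \<comment> \<open>For \<open>S = 0\<close> both sides are 0 by the convention for division by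
    zero.\<close>
  also have "\<dots> = S / 4"
    unfolding prod by (simp add: power2_eq_square power3_eq_cube)
  finally show ?thesis by (simp add: S_def x_def y_def z_def)
qed

section \<open>The reflection law and Joachimsthal's integral\<close>

text \<open>Paired with a point \<open>Q\<close>, this vector gives the symmetric bilinear form that
  polarizes the equation of the ellipse.\<close>

definition ellipse_normal :: "real \<Rightarrow> real \<Rightarrow> real \<times> real \<Rightarrow> real \<times> real" where
  "ellipse_normal a b P = (fst P / a\<^sup>2, snd P / b\<^sup>2)"

lemma ellipse_normal_commute: "ellipse_normal a b P \<bullet> Q = ellipse_normal a b Q \<bullet> P"
  by (simp add: ellipse_normal_def inner_prod_def mult_ac)

lemma ellipse_normal_self: "P \<in> ellipse a b \<Longrightarrow> ellipse_normal a b P \<bullet> P = 1"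
  by (cases P) (simp add: ellipse_normal_def ellipse_def power2_eq_square)

lemma dist_mult_normal:
  assumes "P \<in> ellipse a b" "P \<noteq> Q"
  shows "dist P Q * (ellipse_normal a b P \<bullet> sgn (Q - P)) = ellipse_normal a b P \<bullet> Q - 1"
proof -
  have "dist P Q * (ellipse_normal a b P \<bullet> sgn (Q - P)) = ellipse_normal a b P \<bullet> (Q - P)"
    by (metis dist_scaleR_sgn inner_scaleR_right)
  then show ?thesis using assms by (simp add: inner_diff_right ellipse_normal_self)
qed

text \<open>Multiplied by the length of the chord, both sides become the bilinear form at
  \<open>P\<close> and \<open>Q\<close> minus 1, which is symmetric.\<close>

lemma joachimsthal_chord:
  assumes "P \<in> ellipse a b" "Q \<in> ellipse a b" "P \<noteq> Q"
  shows "ellipse_normal a b P \<bullet> sgn (Q - P) = ellipse_normal a b Q \<bullet> sgn (P - Q)"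
proof -
  have "dist P Q * (ellipse_normal a b P \<bullet> sgn (Q - P)) = dist P Q * (ellipse_normal a b Q \<bullet> sgn (P - Q))"
    using dist_mult_normal[of P a b Q] dist_mult_normal[of Q a b P] assms
    by (simp add: dist_commute ellipse_normal_commute)
  then show ?thesis using assms by simp
qed

text \<open>The bisector point \<open>B + (sgn (A - B) + sgn (C - B))\<close> lies on the normal
  line, so the sum of the unit vectors is a nonzero multiple of the normal, and it is orthogonal to
  their difference.\<close>

lemma billiard_reflection:
  assumes nc: "\<not> collinear {A, B, C}" and "normal_line a b B = affine hull (bisector_ray A B C)"
  obtains t where "sgn (A - B) + sgn (C - B) = t *\<^sub>R ellipse_normal a b B"
    and "ellipse_normal a b B \<bullet> sgn (A - B) = ellipse_normal a b B \<bullet> sgn (C - B)"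
proof -
  note n = not_collinear_sgn[OF nc]
  have "B + (sgn (A - B) + sgn (C - B)) \<in> normal_line a b B"
    unfolding assms(2) using n by (intro hull_inc add_sgn_in_bisector_ray) auto
  then obtain t where t: "sgn (A - B) + sgn (C - B) = t *\<^sub>R ellipse_normal a b B"
    by (auto simp: normal_line_def ellipse_normal_def)
  have "t * (ellipse_normal a b B \<bullet> (sgn (A - B) - sgn (C - B))) = 0"
    using inner_add_diff_sgn[of "A - B" "C - B"] n unfolding t by simp
  moreover have "t \<noteq> 0" using n t by auto
  ultimately show ?thesis using that[OF t] by (simp add: inner_diff_right)
qed

section \<open>Closed chords on the unit circle\<close>

text \<open>The last assumption is the squared form of
  \<open>J * dist P Q = 1 - ellipse_normal a b P \<bullet> Q\<close> in circle coordinates. One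
  factor \<open>1 - Re (z * cnj w)\<close> cancels.\<close>

lemma unit_chord_eq:
  fixes z w :: complex and J a b :: real
  assumes "norm z = 1" "norm w = 1" "z \<noteq> w"
    and "J\<^sup>2 * (a\<^sup>2 * (Re (z - w))\<^sup>2 + b\<^sup>2 * (Im (z - w))\<^sup>2) = (1 - Re (z * cnj w))\<^sup>2"
  shows "z\<^sup>2 + w\<^sup>2 - of_real (J\<^sup>2 * (a\<^sup>2 - b\<^sup>2)) * (z\<^sup>2 * w\<^sup>2 + 1) =
    2 * of_real (1 - J\<^sup>2 * (a\<^sup>2 + b\<^sup>2)) * z * w"
proof -
  define k g where "k = J\<^sup>2 * (a\<^sup>2 - b\<^sup>2)" and "g = 1 - J\<^sup>2 * (a\<^sup>2 + b\<^sup>2)"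
  obtain c1 s1 c2 s2 where e: "z = Complex c1 s1" "w = Complex c2 s2" by (metis complex.exhaust)
  have n: "c1^2 + s1^2 = 1" "c2^2 + s2^2 = 1"
    using assms(1,2) by (simp_all add: e complex_norm)
  \<comment> \<open>For arguments \<open>\<alpha>\<close>, \<open>\<beta>\<close> of
    \<open>z\<close>, \<open>w\<close> these are \<open>1 - cos (\<alpha> - \<beta>)\<close> and
    \<open>cos (\<alpha> + \<beta>)\<close>.\<close>
  define m h where "m = 1 - (c1 * c2 + s1 * s2)" and "h = c1 * c2 - s1 * s2"
  have sq: "(c1 - c2)^2 = m * (1 - h)" "(s1 - s2)^2 = m * (1 + h)"
    unfolding m_def h_def using n by algebra+
  have m0: "m \<noteq> 0"
  proof
    assume "m = 0"
    with sq have "c1 = c2" "s1 = s2" by auto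
    with assms(3) show False by (simp add: e)
  qed
  have "J\<^sup>2 * (a\<^sup>2 * (m * (1 - h)) + b\<^sup>2 * (m * (1 + h))) = m^2"
    unfolding sq[symmetric] using assms(4) by (simp add: e m_def)
  then have "m * (J\<^sup>2 * (a\<^sup>2 + b\<^sup>2) - k * h) = m * m"
    by (simp add: k_def power2_eq_square algebra_simps)
  then have "(1 - m) - k * h = g" using m0 by (simp add: g_def)
  then have r: "Re (z * cnj w) - k * Re (z * w) = g" by (simp add: e m_def h_def)
  have zz: "z * cnj z = 1" "w * cnj w = 1"
    using assms(1,2) by (simp_all add: complex_norm_square[symmetric])
  have "(z * cnj w + cnj z * w) - of_real k * (z * w + cnj z * cnj w) = 2 * of_real g"
    unfolding r[symmetric] by (simp add: complex_eq_iff)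
  \<comment> \<open>Multiply by \<open>z * w\<close>; on the unit circle conjugates are
    inverses.\<close>
  then have "z^2 + w^2 - of_real k * (z^2 * w^2 + 1) = 2 * of_real g * z * w"
    using zz by algebra
  then show ?thesis by (simp add: k_def g_def)
qed

lemma symmetric_functions_of_closed_chords:
  fixes z1 z2 z3 :: complex and k g :: real
  assumes n: "norm z1 = 1" "norm z2 = 1" "norm z3 = 1"
    and d: "z1 \<noteq> z2" "z2 \<noteq> z3" "z3 \<noteq> z1"
    and e: "z1\<^sup>2 + z2\<^sup>2 - of_real k * (z1\<^sup>2 * z2\<^sup>2 + 1) = 2 * of_real g * z1 * z2"
      "z2\<^sup>2 + z3\<^sup>2 - of_real k * (z2\<^sup>2 * z3\<^sup>2 + 1) = 2 * of_real g * z2 * z3"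
      "z3\<^sup>2 + z1\<^sup>2 - of_real k * (z3\<^sup>2 * z1\<^sup>2 + 1) = 2 * of_real g * z3 * z1"
  shows "1 + 2 * g = k\<^sup>2"
    and "Re (z1 * cnj z2) + Re (z2 * cnj z3) + Re (z3 * cnj z1) = (k\<^sup>2 - 3) / 2"
proof -
  define e1 e2 e3 where "e1 = z1 + z2 + z3" and "e2 = z1*z2 + z2*z3 + z3*z1" and "e3 = z1*z2*z3"
  define K G where "K = complex_of_real k" and "G = complex_of_real g"
  \<comment> \<open>Each line subtracts two chord equations that share a vertex; the difference of
    the other two vertices factors out.\<close>
  have "(z2 - z3) * (e1 + K * e3 - z1 * (1 + 2*G + K*e2)) = 0"
    "(z3 - z1) * (e1 + K * e3 - z2 * (1 + 2*G + K*e2)) = 0"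
    using e unfolding e1_def e2_def e3_def K_def[symmetric] G_def[symmetric] by algebra+
  then have l: "e1 + K * e3 = z1 * (1 + 2*G + K*e2)" "e1 + K * e3 = z2 * (1 + 2*G + K*e2)"
    using d by auto
  then have "(z1 - z2) * (1 + 2*G + K*e2) = 0" by algebra
  then have l2: "1 + 2*G + K*e2 = 0" using d by simp
  with l have l1: "e1 = - K * e3" by (simp add: eq_neg_iff_add_eq_0)
  have zz: "z1 * cnj z1 = 1" "z2 * cnj z2 = 1" "z3 * cnj z3 = 1"
    using n by (simp_all add: complex_norm_square[symmetric])
  have "cnj e1 = - K * cnj e3" using arg_cong[OF l1, of cnj] by (simp add: K_def)
  moreover have "e2 = cnj e1 * e3" "cnj e3 * e3 = 1"
    unfolding e1_def e2_def e3_def complex_cnj_add complex_cnj_mult using zz by algebra+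
  ultimately have e2: "e2 = - K" by (simp add: mult.assoc)
  with l2 have "complex_of_real (1 + 2 * g) = of_real (k\<^sup>2)"
    by (simp add: K_def G_def power2_eq_square)
  then show "1 + 2 * g = k\<^sup>2" by (simp only: of_real_eq_iff)
  have "e1 * cnj e1 = K * K"
    using \<open>cnj e1 = _\<close> l1 \<open>cnj e3 * e3 = 1\<close> by algebra
  moreover have "e1 * cnj e1 = 3 + (z1 * cnj z2 + cnj z1 * z2) + (z2 * cnj z3 + cnj z2 * z3)
      + (z3 * cnj z1 + cnj z3 * z1)"
    unfolding e1_def complex_cnj_add using zz by algebra
  moreover define S where "S = Re (z1 * cnj z2) + Re (z2 * cnj z3) + Re (z3 * cnj z1)"
  ultimately have "3 + 2 * S = k\<^sup>2"
    by (simp add: K_def complex_eq_iff power2_eq_square mult.commute)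
  then show "Re (z1 * cnj z2) + Re (z2 * cnj z3) + Re (z3 * cnj z1) = (k\<^sup>2 - 3) / 2"
    unfolding S_def[symmetric] by simp
qed

section \<open>From the ellipse to the unit circle\<close>

text \<open>The affine map onto the unit circle, with complex values so that the relations between
  chords become polynomial.\<close>

definition ellipse_param :: "real \<Rightarrow> real \<Rightarrow> real \<times> real \<Rightarrow> complex" where
  "ellipse_param a b P = Complex (fst P / a) (snd P / b)"

lemma ellipse_param:
  assumes "a > 0" "b > 0"
  shows "P \<in> ellipse a b \<Longrightarrow> norm (ellipse_param a b P) = 1"
    and "ellipse_param a b P = ellipse_param a b Q \<longleftrightarrow> P = Q"
    and "Re (ellipse_param a b P * cnj (ellipse_param a b Q)) = ellipse_normal a b P \<bullet> Q"
    and "(dist P Q)\<^sup>2 = a\<^sup>2 * (Re (ellipse_param a b P - ellipse_param a b Q))\<^sup>2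
      + b\<^sup>2 * (Im (ellipse_param a b P - ellipse_param a b Q))\<^sup>2"
proof -
  show "P \<in> ellipse a b \<Longrightarrow> norm (ellipse_param a b P) = 1"
    by (cases P) (simp add: ellipse_param_def ellipse_def complex_norm power_divide)
  show "ellipse_param a b P = ellipse_param a b Q \<longleftrightarrow> P = Q"
    using assms by (simp add: ellipse_param_def prod_eq_iff)
  show "Re (ellipse_param a b P * cnj (ellipse_param a b Q)) = ellipse_normal a b P \<bullet> Q"
    by (simp add: ellipse_param_def ellipse_normal_def inner_prod_def power2_eq_square)
  have "a * (fst P / a - fst Q / a) = fst P - fst Q" "b * (snd P / b - snd Q / b) = snd P - snd Q"
    using assms by (simp_all add: field_simps)
  then show "(dist P Q)\<^sup>2 = a\<^sup>2 * (Re (ellipse_param a b P - ellipse_param a b Q))\<^sup>2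
      + b\<^sup>2 * (Im (ellipse_param a b P - ellipse_param a b Q))\<^sup>2"
    by (simp add: ellipse_param_def dist_prod_def dist_real_def power_mult_distrib[symmetric]
)
qed

section \<open>Invariants of an orbit\<close>

text \<open>\<open>J\<close> is Joachimsthal's constant. Its equation has coefficients in
  \<open>a\<close> and \<open>b\<close> only, so the orbit enters the product only through
  \<open>J\<close>.\<close>

lemma billiard_orbit3_invariants:
  assumes ab: "a > 0" "b > 0" and orb: "billiard_orbit3 a b P1 P2 P3"
  obtains J where "J > 0"
    and "3 - 2 * (a\<^sup>2 + b\<^sup>2) * J\<^sup>2 = (a\<^sup>2 - b\<^sup>2)\<^sup>2 * (J\<^sup>2)\<^sup>2"
    and "excentral_cos_product P1 P2 P3 = (1 - (J\<^sup>2 * (a\<^sup>2 - b\<^sup>2))\<^sup>2) / 8"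
proof -
  let ?N = "ellipse_normal a b" and ?z = "ellipse_param a b"
  have E: "P1 \<in> ellipse a b" "P2 \<in> ellipse a b" "P3 \<in> ellipse a b"
    and nc: "\<not> collinear {P2, P1, P3}" "\<not> collinear {P3, P2, P1}" "\<not> collinear {P1, P3, P2}"
      "\<not> collinear {P1, P2, P3}"
    and nl: "normal_line a b P1 = affine hull (bisector_ray P2 P1 P3)"
      "normal_line a b P2 = affine hull (bisector_ray P3 P2 P1)"
      "normal_line a b P3 = affine hull (bisector_ray P1 P3 P2)"
    using orb by (simp_all add: billiard_orbit3_def insert_commute)
  have d: "P1 \<noteq> P2" "P2 \<noteq> P3" "P3 \<noteq> P1" using nc by auto
  obtain t1 where t1: "sgn (P2 - P1) + sgn (P3 - P1) = t1 *\<^sub>R ?N P1"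
      "?N P1 \<bullet> sgn (P2 - P1) = ?N P1 \<bullet> sgn (P3 - P1)"
    using billiard_reflection[OF nc(1) nl(1)] .
  obtain t2 where t2: "sgn (P3 - P2) + sgn (P1 - P2) = t2 *\<^sub>R ?N P2"
      "?N P2 \<bullet> sgn (P3 - P2) = ?N P2 \<bullet> sgn (P1 - P2)"
    using billiard_reflection[OF nc(2) nl(2)] .
  obtain t3 where t3: "sgn (P1 - P3) + sgn (P2 - P3) = t3 *\<^sub>R ?N P3"
      "?N P3 \<bullet> sgn (P1 - P3) = ?N P3 \<bullet> sgn (P2 - P3)"
    using billiard_reflection[OF nc(3) nl(3)] .
  \<comment> \<open>The sign is chosen for \<open>J > 0\<close>: the normal points outward and the
    chord inward.\<close>
  define J where "J = - (?N P1 \<bullet> sgn (P2 - P1))"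
  \<comment> \<open>Reflection equates the two values at a vertex, the chord lemma the two values
    along a side.\<close>
  have J: "?N P1 \<bullet> sgn (P2 - P1) = - J" "?N P1 \<bullet> sgn (P3 - P1) = - J"
    "?N P2 \<bullet> sgn (P3 - P2) = - J" "?N P2 \<bullet> sgn (P1 - P2) = - J"
    "?N P3 \<bullet> sgn (P1 - P3) = - J" "?N P3 \<bullet> sgn (P2 - P3) = - J"
    using t1(2) t2(2) t3(2) joachimsthal_chord[OF E(1,2) d(1)] joachimsthal_chord[OF E(2,3) d(2)]
      joachimsthal_chord[OF E(3,1) d(3)]
    by (simp_all add: J_def)
  have chord_re: "Re (?z P * cnj (?z Q)) = ?N P \<bullet> Q" for P Q
    by (rule ellipse_param(3)[OF ab])
  have side: "J * dist P1 P2 = 1 - Re (?z P1 * cnj (?z P2))"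
    "J * dist P2 P3 = 1 - Re (?z P2 * cnj (?z P3))"
    "J * dist P3 P1 = 1 - Re (?z P3 * cnj (?z P1))"
    using dist_mult_normal[OF E(1) d(1)] dist_mult_normal[OF E(2) d(2)] dist_mult_normal[OF E(3) d(3)] J
    unfolding chord_re by (simp_all add: mult.commute)
  define k g where "k = J\<^sup>2 * (a\<^sup>2 - b\<^sup>2)" and "g = 1 - J\<^sup>2 * (a\<^sup>2 + b\<^sup>2)"
  have chord: "(?z P)\<^sup>2 + (?z Q)\<^sup>2 - of_real k * ((?z P)\<^sup>2 * (?z Q)\<^sup>2 + 1) = 2 * of_real g * ?z P * ?z Q"
    if "P \<in> ellipse a b" "Q \<in> ellipse a b" "P \<noteq> Q" "J * dist P Q = 1 - Re (?z P * cnj (?z Q))" for P Q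
    unfolding k_def g_def
  proof (rule unit_chord_eq)
    show "J\<^sup>2 * (a\<^sup>2 * (Re (?z P - ?z Q))\<^sup>2 + b\<^sup>2 * (Im (?z P - ?z Q))\<^sup>2) = (1 - Re (?z P * cnj (?z Q)))\<^sup>2"
      unfolding that(4)[symmetric] ellipse_param(4)[OF ab, symmetric] by (simp add: power_mult_distrib)
  qed (use that ab in \<open>auto simp: ellipse_param\<close>)
  have zd: "?z P1 \<noteq> ?z P2" "?z P2 \<noteq> ?z P3" "?z P3 \<noteq> ?z P1"
    using d ellipse_param(2)[OF ab] by auto
  note sym = symmetric_functions_of_closed_chords[OF ellipse_param(1)[OF ab E(1)]
      ellipse_param(1)[OF ab E(2)] ellipse_param(1)[OF ab E(3)] zd
      chord[OF E(1,2) d(1) side(1)] chord[OF E(2,3) d(2) side(2)] chord[OF E(3,1) d(3) side(3)]]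
  define L where "L = dist P1 P2 + dist P2 P3 + dist P3 P1"
  have JL: "J * L = 3 - (k\<^sup>2 - 3) / 2"
    unfolding L_def distrib_left side sym(2)[symmetric] by (simp del: times_complex.simps)
  \<comment> \<open>Pair the sum of the unit vectors, a multiple \<open>t\<close> of the normal,
    once with a unit side vector and once with the vertex itself.\<close>
  have vertex: "1 + cos (angle_at A B C) = - J * t" "B \<bullet> (sgn (A - B) + sgn (C - B)) = t"
    if "B \<in> ellipse a b" "A \<noteq> B" "C \<noteq> B" "sgn (A - B) + sgn (C - B) = t *\<^sub>R ?N B" "?N B \<bullet> sgn (A - B) = - J"
    for A B C t
  proof -
    have "sgn (A - B) \<bullet> (sgn (A - B) + sgn (C - B)) = - J * t"
      unfolding that(4) using that(5) by (simp add: inner_commute)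
    then show "1 + cos (angle_at A B C) = - J * t"
      using that(2) by (simp add: inner_add_right inner_sgn_self cos_angle_at)
    show "B \<bullet> (sgn (A - B) + sgn (C - B)) = t"
      unfolding that(4) using ellipse_normal_self[OF that(1)] by (simp add: inner_commute)
  qed
  have v1: "1 + cos (angle_at P2 P1 P3) = - J * t1" "P1 \<bullet> (sgn (P2 - P1) + sgn (P3 - P1)) = t1"
    using vertex[OF E(1) _ _ t1(1) J(1)] d by auto
  have v2: "1 + cos (angle_at P3 P2 P1) = - J * t2" "P2 \<bullet> (sgn (P3 - P2) + sgn (P1 - P2)) = t2"
    using vertex[OF E(2) _ _ t2(1) J(3)] d by auto
  have v3: "1 + cos (angle_at P1 P3 P2) = - J * t3" "P3 \<bullet> (sgn (P1 - P3) + sgn (P2 - P3)) = t3"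
    using vertex[OF E(3) _ _ t3(1) J(5)] d by auto
  have ds: "dist P Q = (Q - P) \<bullet> sgn (Q - P)" for P Q :: "real \<times> real"
    by (cases "P = Q") (simp_all add: sgn_div_norm dist_norm norm_minus_commute
        power2_norm_eq_inner[symmetric] power2_eq_square)
  \<comment> \<open>The two terms belonging to a side combine to minus its length.\<close>
  have "t1 + t2 + t3 = - L"
    unfolding v1(2)[symmetric] v2(2)[symmetric] v3(2)[symmetric] L_def ds
    unfolding sgn_diff_commute[of P1 P2] sgn_diff_commute[of P2 P3] sgn_diff_commute[of P3 P1]
    by (simp add: inner_add_right inner_diff_left inner_diff_right)
  moreover have "3 + (cos (angle_at P2 P1 P3) + cos (angle_at P3 P2 P1) + cos (angle_at P1 P3 P2)) =
      - J * (t1 + t2 + t3)"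
    using v1(1) v2(1) v3(1) by (simp add: distrib_left)
  ultimately have "cos (angle_at P2 P1 P3) + cos (angle_at P3 P2 P1) + cos (angle_at P1 P3 P2) = J * L - 3"
    by simp
  then have prod: "excentral_cos_product P1 P2 P3 = (1 - k\<^sup>2) / 8"
    unfolding excentral_cos_product_eq[OF nc(4)] JL by (simp add: field_simps)
  have "J > 0"
  proof -
    have "Re (?z P1 * cnj (?z P2)) \<le> norm (?z P1 * cnj (?z P2))" by (rule complex_Re_le_cmod)
    also have "\<dots> = 1" using ellipse_param(1)[OF ab] E by (simp add: norm_mult)
    finally have "J * dist P1 P2 \<ge> 0" using side(1) by simp
    then have "J \<ge> 0" using d by (simp add: zero_le_mult_iff)
    \<comment> \<open>\<open>J = 0\<close> would give \<open>k = 0\<close> and \<open>g = 1\<close>,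
      so \<open>1 + 2 * g = k\<^sup>2\<close> would read \<open>3 = 0\<close>.\<close>
    moreover have "J \<noteq> 0"
    proof
      assume "J = 0"
      with sym(1) show False by (simp add: k_def g_def)
    qed
    ultimately show ?thesis by simp
  qed
  moreover have "3 - 2 * (a\<^sup>2 + b\<^sup>2) * J\<^sup>2 = (a\<^sup>2 - b\<^sup>2)\<^sup>2 * (J\<^sup>2)\<^sup>2"
    using sym(1) unfolding k_def g_def by algebra
  ultimately show ?thesis using prod that by (simp add: k_def)
qed

section \<open>Uniqueness of the constant\<close>

text \<open>The difference of the equations factors, and the cofactor of \<open>x - y\<close> is
  positive. The case \<open>q = 0\<close>, where the equation is linear, is that of a
  circle.\<close>

lemma quadratic_positive_root_unique:
  fixes p q x y :: real
  assumes "p > 0" "q \<ge> 0" "x > 0" "y > 0" "r - p * x = q * x\<^sup>2" "r - p * y = q * y\<^sup>2"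
  shows "x = y"
proof -
  have "(x - y) * (p + q * (x + y)) = 0" using assms(5,6) by algebra
  moreover have "p + q * (x + y) > 0" using assms by (intro add_pos_nonneg) auto
  ultimately show ?thesis by simp
qed

theorem corollary3:
  fixes a b :: real and P1 P2 P3 Q1 Q2 Q3 :: "real \<times> real"
  assumes "a > 0" and "b > 0"
    and "billiard_orbit3 a b P1 P2 P3"
    and "billiard_orbit3 a b Q1 Q2 Q3"
  shows "excentral_cos_product P1 P2 P3 = excentral_cos_product Q1 Q2 Q3"
proof -
  obtain J where J: "J > 0" "3 - 2 * (a\<^sup>2 + b\<^sup>2) * J\<^sup>2 = (a\<^sup>2 - b\<^sup>2)\<^sup>2 * (J\<^sup>2)\<^sup>2"
    "excentral_cos_product P1 P2 P3 = (1 - (J\<^sup>2 * (a\<^sup>2 - b\<^sup>2))\<^sup>2) / 8"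
    using billiard_orbit3_invariants[OF assms(1-3)] .
  obtain K where K: "K > 0" "3 - 2 * (a\<^sup>2 + b\<^sup>2) * K\<^sup>2 = (a\<^sup>2 - b\<^sup>2)\<^sup>2 * (K\<^sup>2)\<^sup>2"
    "excentral_cos_product Q1 Q2 Q3 = (1 - (K\<^sup>2 * (a\<^sup>2 - b\<^sup>2))\<^sup>2) / 8"
    using billiard_orbit3_invariants[OF assms(1,2,4)] .
  have "J\<^sup>2 = K\<^sup>2"
    using J K assms(1,2)
    by (intro quadratic_positive_root_unique[OF _ _ _ _ J(2) K(2)]) (auto intro: add_pos_pos)
  with J K show ?thesis by simp
qed

end
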